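(* Let $m,n$ be positive integers. If $\mathcal{M}\in\mathbb{R}^{[2m,n]}$ is a $T$-column sufficient tensor on $\mathbb{R}^{[m,n]}_{+}$, then $\mathrm{TLCP}(\mathcal{M},\mathcal{Q})$ has a unique solution for every $\mathcal{Q}\in\mathbb{R}^{[m,n]}_{++}$.
   Context: Write $[n]=\{1,\dots,n\}$. $\mathbb{R}^{[m,n]}$ denotes the set of $m$-th order $n$-dimensional real tensors $\mathcal{Z}=(z_{i_1\ldots i_m})$ with $i_j\in[n]$ for $j\in[m]$, with entrywise operations and inner product $\langle\mathcal{X},\mathcal{Y}\rangle=\sum_{i_1,\dots,i_m=1}^n x_{i_1\ldots i_m}y_{i_1\ldots i_m}$. $\mathbb{R}^{[m,n]}_{+}$ (resp. $\mathbb{R}^{[m,n]}_{++}$) is the subset of tensors all of whose entries are nonnegative (resp. positive). For $\mathcal{M}=(m_{i_1\ldots i_{2m}})\in\mathbb{R}^{[2m,n]}$ and $\mathcal{Z}\in\mathbb{R}^{[m,n]}$, the tensor $\mathcal{M}\mathcal{Z}\in\mathbb{R}^{[m,n]}$ is defined by $(\mathcal{M}\mathcal{Z})_{i_1\ldots i_m}=\sum_{i_{m+1},\dots,i_{2m}=1}^n m_{i_1\ldots i_m i_{m+1}\ldots i_{2m}}z_{i_{m+1}\ldots i_{2m}}$. $\mathcal{M}\in\mathbb{R}^{[2m,n]}$ is $T$-column sufficient on $\mathbb{R}^{[m,n]}_{+}$ if for every $\mathcal{Z}\in\mathbb{R}^{[m,n]}_{+}$: if $z_{i_1\ldots i_m}(\mathcal{M}\mathcal{Z})_{i_1\ldots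 i_m}\le 0$ for all $i_1,\dots,i_m\in[n]$, then $z_{i_1\ldots i_m}(\mathcal{M}\mathcal{Z})_{i_1\ldots i_m}=0$ for all $i_1,\dots,i_m\in[n]$. $\mathrm{TLCP}(\mathcal{M},\mathcal{Q})$ is the problem of finding $\mathcal{Z}\in\mathbb{R}^{[m,n]}_{+}$ with $\mathcal{M}\mathcal{Z}+\mathcal{Q}\in\mathbb{R}^{[m,n]}_{+}$ and $\langle\mathcal{Z},\mathcal{M}\mathcal{Z}+\mathcal{Q}\rangle=0$; any such $\mathcal{Z}$ is called a solution. *)

theory Defs
  imports Complex_Main "HOL-Library.FuncSet"
begin

text \<open>
  A multi-index \<open>(i\<^sub>1, \<dots>, i\<^sub>m)\<close> is the list \<open>[i\<^sub>1, \<dots>, i\<^sub>m]\<close>.  Tensors are extensional functions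
  on the multi-indices, so that equality of functions is equality of tensors.
\<close>

definition multi_indices :: "nat \<Rightarrow> nat \<Rightarrow> nat list set" where
  "multi_indices m n = {is. length is = m \<and> set is \<subseteq> {1..n}}"

definition tensors :: "nat \<Rightarrow> nat \<Rightarrow> (nat list \<Rightarrow> real) set" where
  "tensors m n = multi_indices m n \<rightarrow>\<^sub>E UNIV"

definition nonneg_tensors :: "nat \<Rightarrow> nat \<Rightarrow> (nat list \<Rightarrow> real) set" where
  "nonneg_tensors m n = {Z \<in> tensors m n. \<forall>is \<in> multi_indices m n. 0 \<le> Z is}"

definition pos_tensors :: "nat \<Rightarrow> nat \<Rightarrow> (nat list \<Rightarrow> real) set" where
  "pos_tensors m n = {Z \<in> tensors m n. \<forall>is \<in> multi_indices m n. 0 < Z is}"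

definition tensor_add ::
  "nat \<Rightarrow> nat \<Rightarrow> (nat list \<Rightarrow> real) \<Rightarrow> (nat list \<Rightarrow> real) \<Rightarrow> (nat list \<Rightarrow> real)" where
  "tensor_add m n X Y = (\<lambda>is \<in> multi_indices m n. X is + Y is)"

definition tensor_inner ::
  "nat \<Rightarrow> nat \<Rightarrow> (nat list \<Rightarrow> real) \<Rightarrow> (nat list \<Rightarrow> real) \<Rightarrow> real" where
  "tensor_inner m n X Y = (\<Sum>is \<in> multi_indices m n. X is * Y is)"

definition tensor_mult ::
  "nat \<Rightarrow> nat \<Rightarrow> (nat list \<Rightarrow> real) \<Rightarrow> (nat list \<Rightarrow> real) \<Rightarrow> (nat list \<Rightarrow> real)" where
  "tensor_mult m n M Z =
    (\<lambda>is \<in> multi_indices m n. \<Sum>js \<in> multi_indices m n. M (is @ js) * Z js)"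

definition T_column_sufficient :: "nat \<Rightarrow> nat \<Rightarrow> (nat list \<Rightarrow> real) \<Rightarrow> bool" where
  "T_column_sufficient m n M \<longleftrightarrow>
    (\<forall>Z \<in> nonneg_tensors m n.
      (\<forall>is \<in> multi_indices m n. Z is * tensor_mult m n M Z is \<le> 0) \<longrightarrow>
      (\<forall>is \<in> multi_indices m n. Z is * tensor_mult m n M Z is = 0))"

definition TLCP_solution ::
  "nat \<Rightarrow> nat \<Rightarrow> (nat list \<Rightarrow> real) \<Rightarrow> (nat list \<Rightarrow> real) \<Rightarrow> (nat list \<Rightarrow> real) \<Rightarrow> bool" where
  "TLCP_solution m n M Q Z \<longleftrightarrow>
    Z \<in> nonneg_tensors m n \<and>
    tensor_add m n (tensor_mult m n M Z) Q \<in> nonneg_tensors m n \<and>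
    tensor_inner m n Z (tensor_add m n (tensor_mult m n M Z) Q) = 0"

end

theory Submission imports Defs
begin

text \<open>
  The zero tensor solves the problem because \<open>Q\<close> is nonnegative. Conversely, the inner product of a
  solution \<open>Z\<close> with \<open>M Z + Q\<close> is a vanishing sum of nonnegative terms, so complementarity holds
  entrywise (\<open>TLCP_solution_complementary\<close>): \<open>z\<^sub>i (M Z)\<^sub>i = - z\<^sub>i q\<^sub>i \<le> 0\<close> for each multi-index \<open>i\<close>.
  This is exactly the hypothesis of column sufficiency at \<open>Z\<close>; hence \<open>z\<^sub>i q\<^sub>i = 0\<close>, and \<open>q\<^sub>i > 0\<close>
  forces \<open>z\<^sub>i = 0\<close>.
\<close>

lemma finite_multi_indices: "finite (multi_indices m n)"
proof -
  have "multi_indices m n = {is. set is \<subseteq> {1..n} \<and> length is = m}"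
    by (auto simp: multi_indices_def)
  then show ?thesis
    by (simp add: finite_lists_length_eq)
qed

lemma TLCP_solution_zero:
  assumes "Q \<in> nonneg_tensors m n"
  shows "TLCP_solution m n M Q (\<lambda>is \<in> multi_indices m n. 0)"
  using assms
  by (auto simp: TLCP_solution_def nonneg_tensors_def tensors_def tensor_add_def
      tensor_mult_def tensor_inner_def)

lemma TLCP_solution_complementary:
  assumes sol: "TLCP_solution m n M Q Z" and i: "is \<in> multi_indices m n"
  shows "Z is * (tensor_mult m n M Z is + Q is) = 0"
proof -
  let ?W = "tensor_add m n (tensor_mult m n M Z) Q"
  have nonneg: "0 \<le> Z js * ?W js" if "js \<in> multi_indices m n" for js
    using sol that by (auto simp: TLCP_solution_def nonneg_tensors_def)
  have "(\<Sum>js \<in> multi_indices m n. Z js * ?W js) = 0"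
    using sol by (simp add: TLCP_solution_def tensor_inner_def)
  then have "Z is * ?W is = 0"
    using i by (simp add: sum_nonneg_eq_0_iff finite_multi_indices nonneg del: mult_eq_0_iff)
  then show ?thesis
    using i by (simp add: tensor_add_def)
qed

lemma TLCP_solution_unique_zero:
  assumes suff: "T_column_sufficient m n M"
    and Q: "Q \<in> pos_tensors m n"
    and sol: "TLCP_solution m n M Q Z"
  shows "Z = (\<lambda>is \<in> multi_indices m n. 0)"
proof -
  have Z: "Z \<in> nonneg_tensors m n"
    using sol by (simp add: TLCP_solution_def)
  have Q_pos: "0 < Q is" if "is \<in> multi_indices m n" for "is"
    using Q that by (simp add: pos_tensors_def)
  have MZ: "Z is * tensor_mult m n M Z is = - (Z is * Q is)"
    if "is \<in> multi_indices m n" for "is"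
    using TLCP_solution_complementary[OF sol that] by (simp add: algebra_simps)
  have "Z is * tensor_mult m n M Z is \<le> 0" if "is \<in> multi_indices m n" for "is"
    using MZ[OF that] Q_pos[OF that] Z that by (simp add: nonneg_tensors_def)
  then have zero: "Z is * tensor_mult m n M Z is = 0" if "is \<in> multi_indices m n" for "is"
    using suff Z that unfolding T_column_sufficient_def by blast
  have "Z is = 0" if "is \<in> multi_indices m n" for "is"
    using zero[OF that] MZ[OF that] Q_pos[OF that] by simp
  moreover have "Z \<in> extensional (multi_indices m n)"
    using Z by (auto simp: nonneg_tensors_def tensors_def PiE_def)
  ultimately show ?thesis
    by (intro extensionalityI[of _ "multi_indices m n"]) auto
qed

theorem theorem4p5:
  fixes m n :: nat and M :: "nat list \<Rightarrow> real"
  assumes "m \<ge> 1" and "n \<ge> 1"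
    and "M \<in> tensors (2 * m) n"
    and "T_column_sufficient m n M"
  shows "\<forall>Q \<in> pos_tensors m n. \<exists>!Z. TLCP_solution m n M Q Z"
proof
  fix Q
  assume Q: "Q \<in> pos_tensors m n"
  then have "Q \<in> nonneg_tensors m n"
    by (auto simp: pos_tensors_def nonneg_tensors_def less_imp_le)
  then show "\<exists>!Z. TLCP_solution m n M Q Z"
    using TLCP_solution_zero TLCP_solution_unique_zero[OF assms(4) Q] by blast
qed

end
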